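(* Let $N\geq 2$, let $(S_i)_{i\in\mathbb{Z}_N}$ be a representation of the Cuntz algebra $\mathcal{O}_N$ on a Hilbert space $\mathcal{H}$ and let $P$ be the associated projection valued measure on $\mathcal{K}_N$. Suppose $M$ is a finite dimensional subspace of $\mathcal{H}$ which is invariant for $S_i^*$ for all $i\in\mathbb{Z}_N$ and which is cyclic for the representation. Then for any non-periodic word $\omega\in\mathcal{K}_N$, $P(\omega)=0$. For any cyclic word $\omega\in\mathcal{K}_N$, $P(\omega)\mathcal{H}\subset M$.
   Context: $\mathbb{Z}_N=\{0,1,\dots,N-1\}$. A representation of the Cuntz algebra $\mathcal{O}_N$ on a Hilbert space $\mathcal{H}$ is a family $(S_i)_{i\in\mathbb{Z}_N}$ of bounded operators on $\mathcal{H}$ with $S_i^*S_j=\delta_{ij}I$ for all $i,j$ and $\sum_{i\in\mathbb{Z}_N}S_iS_i^*=I$. For a finite word $I=i_1\dots i_n$, $S_I:=S_{i_1}\cdots S_{i_n}$ ($S_\emptyset$ is the identity). $\mathcal{K}_N=\mathbb{Z}_N^{\mathbb{N}}$ is the space of infinite words $\omega=\omega_1\omega_2\dots$ with the product topology; $\sigma(\omega_1\omega_2\dots)=\omega_2\omega_3\dots$ is the shift. The projection valued measure $P$ associated to the representation is the unique projection valued measure on the Borel sets of $\mathcal{K}_N$ with $P(\{\omega:\omega_1=i_1,\dots,\omega_k=i_k\})=S_IS_I^*$ for every finite word $I=i_1\dots i_k$. Write $P(\omega)=P(\{\omega\})$. A word $\omega\in\mathcal{K}_N$ is periodic if $\sigma^k(\omega)=\sigma^{k'}(\omega)$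 for some non-negative integers $k\ne k'$, and cyclic if $\sigma^p(\omega)=\omega$ for some $p>0$. A subspace (or set) $M$ is cyclic for the representation if the closed linear span of $\{S_IS_J^*v: v\in M,\ I,J\text{ finite words}\}$ is $\mathcal{H}$. *)

theory Defs
  imports "HOL-Analysis.Analysis"
begin

section \<open>Complex Hilbert spaces\<close>

text \<open>The norm, topology and completeness are those of the underlying real Hilbert space,
  whose inner product is the real part of the complex one. Positive definiteness of
  \<^term>\<open>cinner\<close> is inherited from \<^class>\<open>real_inner\<close>; see \<open>cinner_self\<close> below.
  The complex inner product is linear in its second argument.\<close>

class complex_hilbert_space = real_inner + complete_space +
  fixes scaleC :: "complex \<Rightarrow> 'a \<Rightarrow> 'a"  (infixr \<open>*\<^sub>C\<close> 75)
    and cinner :: "'a \<Rightarrow> 'a \<Rightarrow> complex"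
  assumes scaleC_add_right: "c *\<^sub>C (x + y) = c *\<^sub>C x + c *\<^sub>C y"
    and scaleC_add_left: "(c + d) *\<^sub>C x = c *\<^sub>C x + d *\<^sub>C x"
    and scaleC_scaleC: "c *\<^sub>C (d *\<^sub>C x) = (c * d) *\<^sub>C x"
    and scaleC_one: "1 *\<^sub>C x = x"
    and scaleR_scaleC: "r *\<^sub>R x = complex_of_real r *\<^sub>C x"
    and cinner_commute: "cinner x y = cnj (cinner y x)"
    and cinner_add_right: "cinner x (y + z) = cinner x y + cinner x z"
    and cinner_scaleC_right: "cinner x (c *\<^sub>C y) = c * cinner x y"
    and inner_eq_Re_cinner: "x \<bullet> y = Re (cinner x y)"

global_interpretation complex_vector:
  vector_space "scaleC :: complex \<Rightarrow> 'a \<Rightarrow> 'a::complex_hilbert_space"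
  by unfold_locales (simp_all add: scaleC_add_right scaleC_add_left scaleC_scaleC scaleC_one)

lemma cinner_self:
  fixes x :: "'a::complex_hilbert_space"
  shows "cinner x x = complex_of_real ((norm x)\<^sup>2)"
proof -
  have "Im (cinner x x) = 0"
    using arg_cong[OF cinner_commute[of x x], of Im] by simp
  then show ?thesis
    by (simp add: complex_eq_iff power2_norm_eq_inner inner_eq_Re_cinner)
qed

definition bounded_clinear ::
    "('a::complex_hilbert_space \<Rightarrow> 'a) \<Rightarrow> bool" where
  "bounded_clinear T \<longleftrightarrow> bounded_linear T \<and> (\<forall>c x. T (c *\<^sub>C x) = c *\<^sub>C T x)"

definition cadjoint ::
    "('a::complex_hilbert_space \<Rightarrow> 'a) \<Rightarrow> ('a \<Rightarrow> 'a)" where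
  "cadjoint T = (THE T'. \<forall>x y. cinner (T x) y = cinner x (T' y))"


subsection \<open>The adjoint is well defined\<close>

lemma riesz_real:
  fixes f :: "'a::{real_inner, complete_space} \<Rightarrow> real"
  assumes "bounded_linear f"
  shows "\<exists>z. \<forall>x. f x = z \<bullet> x"
proof -
  interpret f: bounded_linear f by fact
  define J where "J x = x \<bullet> x - 2 * f x" for x
  obtain K where K: "\<And>x. norm (f x) \<le> norm x * K"
    using f.bounded by blast
  have below: "- K\<^sup>2 \<le> J x" for x
  proof -
    have "0 \<le> (norm x - K)\<^sup>2" by simp
    then have "2 * (norm x * K) \<le> (norm x)\<^sup>2 + K\<^sup>2" by (simp add: power2_diff)
    moreover have "f x \<le> norm x * K" using K[of x] by simp
    ultimately show ?thesis by (simp add: J_def power2_norm_eq_inner)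
  qed
  have bdd: "bdd_below (range J)" by (rule bdd_belowI2) (rule below)
  define m where "m = Inf (range J)"
  have m: "m \<le> J x" for x
    unfolding m_def using bdd by (simp add: cInf_lower)
  have "\<exists>x. J x < m + inverse (real (Suc n))" for n
  proof -
    have "Inf (range J) < m + inverse (real (Suc n))" by (simp add: m_def)
    then show ?thesis using cInf_less_iff[OF _ bdd] by blast
  qed
  then obtain X where X: "\<And>n. J (X n) < m + inverse (real (Suc n))" by metis
  have par: "(norm (x - y))\<^sup>2 \<le> 2 * J x + 2 * J y - 4 * m" for x y
  proof -
    have "(norm (x - y))\<^sup>2 = 2 * J x + 2 * J y - 4 * J ((1/2) *\<^sub>R (x + y))"
      unfolding J_def power2_norm_eq_inner
      by (simp add: f.scaleR f.add inner_add_left inner_add_right inner_diff_left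
          inner_diff_right inner_commute[of y x] field_simps)
    with m[of "(1/2) *\<^sub>R (x + y)"] show ?thesis by simp
  qed
  have "Cauchy X"
  proof (rule CauchyI)
    fix e :: real
    assume "0 < e"
    then obtain M where M: "inverse (real (Suc M)) < e\<^sup>2 / 4"
      using reals_Archimedean[of "e\<^sup>2 / 4"] by auto
    have "norm (X a - X b) < e" if "M \<le> a" "M \<le> b" for a b
    proof -
      have "inverse (real (Suc a)) \<le> inverse (real (Suc M))"
        "inverse (real (Suc b)) \<le> inverse (real (Suc M))"
        using that by (auto intro!: le_imp_inverse_le)
      then have "(norm (X a - X b))\<^sup>2 < e\<^sup>2"
        using par[of "X a" "X b"] X[of a] X[of b] M by linarith
      then show ?thesis using \<open>0 < e\<close> by (simp add: power_less_imp_less_base)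
    qed
    then show "\<exists>M. \<forall>a\<ge>M. \<forall>b\<ge>M. norm (X a - X b) < e" by blast
  qed
  then obtain z where z: "X \<longlonglongrightarrow> z"
    using Cauchy_convergent convergent_def by blast
  have "(\<lambda>n. J (X n)) \<longlonglongrightarrow> J z"
    unfolding J_def by (intro tendsto_intros z f.tendsto)
  moreover have "(\<lambda>n. m + inverse (real (Suc n))) \<longlonglongrightarrow> m + 0"
    by (intro tendsto_intros LIMSEQ_inverse_real_of_nat)
  ultimately have "J z \<le> m + 0"
    using X by (intro LIMSEQ_le[of "\<lambda>n. J (X n)"]) (auto intro: less_imp_le)
  then have min: "J z \<le> J x" for x using m[of x] by simp
  have "f h = z \<bullet> h" for h
  proof (cases "h = 0")
    case True
    then show ?thesis by (simp add: f.zero)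
  next
    case False
    define d where "d = z \<bullet> h - f h"
    define t where "t = - d / (h \<bullet> h)"
    have hh: "0 < h \<bullet> h" using False by simp
    have "J (z + t *\<^sub>R h) = J z + t * t * (h \<bullet> h) + 2 * t * d"
      by (simp add: J_def d_def f.scaleR f.add inner_add_left inner_add_right
          inner_commute[of h z] algebra_simps)
    moreover have "t * t * (h \<bullet> h) + 2 * t * d = - (d * d / (h \<bullet> h))"
      using hh by (simp add: t_def field_simps)
    ultimately have "d * d / (h \<bullet> h) \<le> 0" using min[of "z + t *\<^sub>R h"] by simp
    then have "d * d \<le> 0" using hh by (simp add: divide_le_0_iff)
    then show ?thesis by (auto simp: d_def mult_le_0_iff)
  qed
  then show ?thesis by blast
qed

lemma cinner_cadjoint:
  assumes "bounded_clinear T"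
  shows "cinner (T x) y = cinner x (cadjoint T y)"
proof -
  have T: "bounded_linear T" and TC: "\<And>c x. T (c *\<^sub>C x) = c *\<^sub>C T x"
    using assms by (auto simp: bounded_clinear_def)
  have Im_cinner: "Im (cinner u v) = - (u \<bullet> (\<i> *\<^sub>C v))" for u v :: 'a
    by (simp add: inner_eq_Re_cinner cinner_scaleC_right)
  have "\<exists>z. \<forall>x. cinner (T x) y = cinner x z" for y
  proof -
    have "bounded_linear (\<lambda>x. y \<bullet> T x)"
      by (intro bounded_linear_compose[OF bounded_linear_inner_right T])
    then obtain z where z: "\<And>x. y \<bullet> T x = z \<bullet> x" using riesz_real by blast
    have "cinner y (T x) = cinner z x" for x
      using z[of x] z[of "\<i> *\<^sub>C x"]
      by (simp add: complex_eq_iff Im_cinner TC flip: inner_eq_Re_cinner)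
    then show ?thesis by (metis cinner_commute)
  qed
  then obtain T' where T': "\<forall>x y. cinner (T x) y = cinner x (T' y)" by metis
  have "T'' = T'" if "\<forall>x y. cinner (T x) y = cinner x (T'' y)" for T''
  proof
    fix y
    have "x \<bullet> T'' y = x \<bullet> T' y" for x
      using that T' by (simp add: inner_eq_Re_cinner)
    then show "T'' y = T' y"
      by (metis inner_commute vector_eq_ldot)
  qed
  then have "\<exists>!T'. \<forall>x y. cinner (T x) y = cinner x (T' y)" using T' by blast
  from theI'[OF this] show ?thesis unfolding cadjoint_def by blast
qed


section \<open>Representations of the Cuntz algebra\<close>

text \<open>The alphabet is \<^term>\<open>{..<N}\<close>; the operators are given by a family indexed by \<^typ>\<open>nat\<close>,
  of which only the members with index below \<^term>\<open>N\<close> matter.\<close>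

definition cuntz_rep :: "nat \<Rightarrow> (nat \<Rightarrow> 'a::complex_hilbert_space \<Rightarrow> 'a) \<Rightarrow> bool" where
  "cuntz_rep N S \<longleftrightarrow>
     (\<forall>i<N. bounded_clinear (S i)) \<and>
     (\<forall>i<N. \<forall>j<N. cadjoint (S i) \<circ> S j = (if i = j then id else (\<lambda>_. 0))) \<and>
     (\<forall>x. (\<Sum>i<N. S i (cadjoint (S i) x)) = x)"

definition word_op :: "(nat \<Rightarrow> 'a \<Rightarrow> 'a) \<Rightarrow> nat list \<Rightarrow> 'a \<Rightarrow> 'a" where
  "word_op S I = foldr (\<lambda>i T. S i \<circ> T) I id"

definition cyclic_for_rep ::
    "nat \<Rightarrow> (nat \<Rightarrow> 'a::complex_hilbert_space \<Rightarrow> 'a) \<Rightarrow> 'a set \<Rightarrow> bool" where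
  "cyclic_for_rep N S M \<longleftrightarrow>
     closure (complex_vector.span
       {word_op S I (cadjoint (word_op S J) v) | I J v.
          I \<in> lists {..<N} \<and> J \<in> lists {..<N} \<and> v \<in> M}) = UNIV"


section \<open>Infinite words\<close>

text \<open>Positions are counted from 0: the letter $\omega_{k+1}$ is \<open>\<omega> k\<close>.\<close>

definition word_space :: "nat \<Rightarrow> (nat \<Rightarrow> nat) topology" where
  "word_space N = product_topology (\<lambda>_. discrete_topology {..<N}) UNIV"

abbreviation inf_words :: "nat \<Rightarrow> (nat \<Rightarrow> nat) set" where
  "inf_words N \<equiv> topspace (word_space N)"

lemma mem_inf_words: "\<omega> \<in> inf_words N \<longleftrightarrow> (\<forall>k. \<omega> k < N)"
  by (auto simp: word_space_def PiE_iff)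

definition word_borel :: "nat \<Rightarrow> (nat \<Rightarrow> nat) set set" where
  "word_borel N = sigma_sets (inf_words N) {U. openin (word_space N) U}"

definition cylinder :: "nat \<Rightarrow> nat list \<Rightarrow> (nat \<Rightarrow> nat) set" where
  "cylinder N I = {\<omega> \<in> inf_words N. \<forall>k<length I. \<omega> k = I ! k}"

definition word_shift :: "(nat \<Rightarrow> nat) \<Rightarrow> nat \<Rightarrow> nat" where
  "word_shift \<omega> = (\<lambda>k. \<omega> (Suc k))"

text \<open>Periodic means eventually periodic; cyclic means purely periodic.\<close>

definition periodic_word :: "(nat \<Rightarrow> nat) \<Rightarrow> bool" where
  "periodic_word \<omega> \<longleftrightarrow> (\<exists>k k'. k \<noteq> k' \<and> (word_shift ^^ k) \<omega> = (word_shift ^^ k') \<omega>)"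

definition cyclic_word :: "(nat \<Rightarrow> nat) \<Rightarrow> bool" where
  "cyclic_word \<omega> \<longleftrightarrow> (\<exists>p>0. (word_shift ^^ p) \<omega> = \<omega>)"


section \<open>Projection valued measures\<close>

definition orth_projection :: "('a::complex_hilbert_space \<Rightarrow> 'a) \<Rightarrow> bool" where
  "orth_projection Q \<longleftrightarrow> bounded_clinear Q \<and> Q \<circ> Q = Q \<and> cadjoint Q = Q"

text \<open>Countable additivity is with respect to the strong operator topology.\<close>

definition pvm ::
    "'w set \<Rightarrow> 'w set set \<Rightarrow> ('w set \<Rightarrow> 'a::complex_hilbert_space \<Rightarrow> 'a) \<Rightarrow> bool" where
  "pvm \<Omega> \<A> P \<longleftrightarrow>
     (\<forall>E\<in>\<A>. orth_projection (P E)) \<and>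
     P {} = (\<lambda>_. 0) \<and> P \<Omega> = id \<and>
     (\<forall>E\<in>\<A>. \<forall>F\<in>\<A>. P (E \<inter> F) = P E \<circ> P F) \<and>
     (\<forall>E :: nat \<Rightarrow> 'w set. range E \<subseteq> \<A> \<longrightarrow> disjoint_family E \<longrightarrow>
        (\<forall>x. (\<lambda>n. P (E n) x) sums P (\<Union>n. E n) x))"

text \<open>The condition on cylinders determines \<open>P\<close> on all Borel sets, since the cylinders
  together with the empty set form an intersection-stable generator of the Borel sets.\<close>

definition associated_pvm ::
    "nat \<Rightarrow> (nat \<Rightarrow> 'a::complex_hilbert_space \<Rightarrow> 'a)
       \<Rightarrow> ((nat \<Rightarrow> nat) set \<Rightarrow> 'a \<Rightarrow> 'a) \<Rightarrow> bool" where
  "associated_pvm N S P \<longleftrightarrow>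
     pvm (inf_words N) (word_borel N) P \<and>
     (\<forall>I\<in>lists {..<N}. P (cylinder N I) = word_op S I \<circ> cadjoint (word_op S I))"

end

theory Submission
  imports Defs
begin

text \<open>
  Fix a word \<open>\<omega>\<close>, let \<open>S\<^sub>n\<close> be the product of the operators along its first \<open>n\<close> letters, and for
  a vector \<open>x\<close> consider the orbit \<open>x\<^sub>n = S\<^sub>n\<^sup>* x\<close>. The
  projections \<open>S\<^sub>n S\<^sub>n\<^sup>*\<close> decrease strongly to the projection of the point \<open>\<omega>\<close>, so with
  \<open>w = P {\<omega>} x\<close> the orbits of \<open>x\<close> and \<open>w\<close> become asymptotic (\<open>peel_diff_tendsto_0\<close>), while
  each \<open>S\<^sub>n\<^sup>*\<close> is isometric on the range of \<open>P {\<omega>}\<close>.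

  Call \<open>x\<close> good if \<open>x\<^sub>n\<close> lies in \<open>M\<close> for all large \<open>n\<close>. Invariance of \<open>M\<close> makes every
  \<open>S\<^sub>I S\<^sub>J\<^sup>* v\<close> with \<open>v\<close> in \<open>M\<close> good: peeling off \<open>I\<close> either kills the vector or leaves an
  element of \<open>M\<close>. As \<open>M\<close> is cyclic, the good vectors are dense
  (\<open>closure_eventually_peeled\<close>), and since \<open>P {\<omega>}\<close> is continuous and \<open>M\<close> is closed it
  suffices to show that \<open>w\<close> is zero, respectively in \<open>M\<close>, when \<open>x\<close> is good. For such \<open>x\<close>
  the orbit is bounded and eventually in a finite-dimensional space, so along a subsequence
  it converges, and the orbit of \<open>w\<close> converges along the same subsequence
  (\<open>convergent_peel_subsequence\<close>).

  The vector \<open>w\<^sub>n\<close> lies in the range of the projection of the shifted word \<open>\<sigma>\<^sup>n \<omega>\<close>, and ranges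
  belonging to different words are orthogonal. If \<open>\<omega>\<close> is not periodic, the \<open>w\<^sub>n\<close> are
  therefore pairwise orthogonal of the same norm; a convergent subsequence forces \<open>w = 0\<close>.
  If \<open>\<omega>\<close> is cyclic with period \<open>p\<close>, then along the multiples of \<open>p\<close> the orbit of \<open>w\<close> is that
  of a single isometry, so a convergent subsequence makes \<open>w\<close> recurrent: \<open>w\<^sub>d\<close> is
  arbitrarily close to \<open>w\<close> for arbitrarily large \<open>d\<close>. But \<open>w\<^sub>d\<close> is then also close to
  \<open>x\<^sub>d\<close>, an element of \<open>M\<close>, and hence \<open>w\<close> lies in the closed subspace \<open>M\<close>.
\<close>

section \<open>Finite-dimensional subspaces\<close>

text \<open>This reduces topological questions about a finite-dimensional complex subspace to the
  real inner product, since the topology is that of the underlying real space.\<close>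

lemma complex_span_eq_real_span:
  fixes B :: "'a::complex_hilbert_space set"
  shows "complex_vector.span B = span (B \<union> (*\<^sub>C) \<i> ` B)" (is "_ = span ?B")
proof
  have i_closed: "\<i> *\<^sub>C x \<in> span ?B" if "x \<in> span ?B" for x
    using that
  proof (induction rule: span_induct_alt)
    case base
    have "\<i> *\<^sub>C (0::'a) = 0"
      by (rule complex_vector.scale_zero_right)
    then show ?case by (simp add: span_zero)
  next
    case (step c b y)
    have "\<i> *\<^sub>C b \<in> span ?B"
    proof (cases "b \<in> B")
      case True
      then show ?thesis by (auto intro: span_base)
    next
      case False
      with step(1) obtain b' where b': "b' \<in> B" "b = \<i> *\<^sub>C b'" by auto
      have "\<i> *\<^sub>C b = - b'"
        using scaleR_scaleC[of "-1" b'] by (simp add: b'(2) scaleC_scaleC)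
      with b' show ?thesis by (auto intro: span_base span_neg)
    qed
    moreover have "\<i> *\<^sub>C (c *\<^sub>R b + y) = c *\<^sub>R (\<i> *\<^sub>C b) + \<i> *\<^sub>C y"
      by (simp add: scaleR_scaleC scaleC_add_right scaleC_scaleC mult.commute)
    ultimately show ?case
      using step(2) by (simp add: span_add span_scale)
  qed
  have scaleC_closed: "c *\<^sub>C x \<in> span ?B" if "x \<in> span ?B" for c x
  proof -
    have "c *\<^sub>C x = (of_real (Re c) + of_real (Im c) * \<i>) *\<^sub>C x"
      by (metis complex_eq mult.commute)
    also have "\<dots> = Re c *\<^sub>R x + Im c *\<^sub>R (\<i> *\<^sub>C x)"
      by (simp add: scaleC_add_left scaleR_scaleC scaleC_scaleC)
    finally show ?thesis
      using that i_closed by (simp add: span_add span_scale)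
  qed
  have "complex_vector.subspace (span ?B)"
    by (rule complex_vector.subspaceI) (auto simp: span_zero span_add scaleC_closed)
  then show "complex_vector.span B \<subseteq> span ?B"
    by (rule complex_vector.span_minimal[rotated]) (auto intro: span_base)
  have "subspace (complex_vector.span B)"
    by (auto simp: subspace_def scaleR_scaleC complex_vector.span_zero
        complex_vector.span_add complex_vector.span_scale)
  then show "span ?B \<subseteq> complex_vector.span B"
    by (rule span_minimal[rotated])
      (auto intro: complex_vector.span_base complex_vector.span_scale)
qed

lemma orthogonal_expansion:
  fixes C :: "'a::real_inner set"
  assumes "finite C" "pairwise orthogonal C" "x \<in> span C"
  shows "x = (\<Sum>c\<in>C. (x \<bullet> c / (c \<bullet> c)) *\<^sub>R c)"
proof -
  from assms(1,3) obtain u where u: "x = (\<Sum>c\<in>C. u c *\<^sub>R c)"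
    by (auto simp: span_finite)
  have "(x \<bullet> c / (c \<bullet> c)) *\<^sub>R c = u c *\<^sub>R c" if c: "c \<in> C" for c
  proof (cases "c = 0")
    case False
    have "x \<bullet> c = (\<Sum>d\<in>C. u d * (d \<bullet> c))"
      by (simp add: u inner_sum_left)
    also have "\<dots> = (\<Sum>d\<in>C. if d = c then u c * (c \<bullet> c) else 0)"
      using assms(2) c by (intro sum.cong) (auto simp: pairwise_def orthogonal_def)
    also have "\<dots> = u c * (c \<bullet> c)"
      using assms(1) c by simp
    finally show ?thesis using False by simp
  qed simp
  then have "(\<Sum>c\<in>C. (x \<bullet> c / (c \<bullet> c)) *\<^sub>R c) = (\<Sum>c\<in>C. u c *\<^sub>R c)"
    by (rule sum.cong[OF refl])
  then show ?thesis using u by (rule trans[OF _ sym, THEN sym])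
qed

text \<open>The ambient space may be infinite-dimensional. By Gram-Schmidt the span is the set where
  the continuous map given by the orthogonal expansion agrees with the identity.\<close>

lemma closed_span_finite:
  fixes B :: "'a::real_inner set"
  assumes "finite B"
  shows "closed (span B)"
proof -
  obtain C where C: "finite C" "span C = span B" "pairwise orthogonal C"
    using basis_orthogonal[OF assms] by blast
  have "(\<Sum>c\<in>C. (x \<bullet> c / (c \<bullet> c)) *\<^sub>R c) \<in> span C" for x
    by (intro span_sum span_scale span_base)
  then have "span C = {x. x = (\<Sum>c\<in>C. (x \<bullet> c / (c \<bullet> c)) *\<^sub>R c)}"
    using orthogonal_expansion[OF C(1,3)] by auto (metis (no_types, lifting))
  moreover have "closed {x. x = (\<Sum>c\<in>C. (x \<bullet> c / (c \<bullet> c)) *\<^sub>R c)}"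
    unfolding divide_inverse by (intro closed_Collect_eq continuous_intros)
  ultimately show ?thesis using C(2) by simp
qed

lemma compact_bounded_combinations:
  fixes C :: "'a::real_normed_vector set" and b :: "'a \<Rightarrow> real"
  assumes "finite C"
  shows "compact {\<Sum>c\<in>C. u c *\<^sub>R c | u. \<forall>c\<in>C. \<bar>u c\<bar> \<le> b c}" (is "compact (?K C)")
  using assms
proof (induction C)
  case empty
  show ?case by simp
next
  case (insert a C)
  have "compact ((\<lambda>t. t *\<^sub>R a) ` {- b a..b a})"
    by (intro compact_continuous_image continuous_intros compact_Icc)
  from compact_sums[OF this insert.IH]
  have "compact {x + y |x y. x \<in> (\<lambda>t. t *\<^sub>R a) ` {- b a..b a} \<and> y \<in> ?K C}" .
  moreover have "{x + y |x y. x \<in> (\<lambda>t. t *\<^sub>R a) ` {- b a..b a} \<and> y \<in> ?K C} = ?K (insert a C)"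
    (is "?L = _")
  proof
    show "?L \<subseteq> ?K (insert a C)"
    proof
      fix z assume "z \<in> ?L"
      then obtain t u where tu: "t \<in> {- b a..b a}" "\<forall>c\<in>C. \<bar>u c\<bar> \<le> b c"
        "z = t *\<^sub>R a + (\<Sum>c\<in>C. u c *\<^sub>R c)" by blast
      have "(\<Sum>c\<in>C. (u(a := t)) c *\<^sub>R c) = (\<Sum>c\<in>C. u c *\<^sub>R c)"
        using insert.hyps by (intro sum.cong) auto
      then have "z = (\<Sum>c\<in>insert a C. (u(a := t)) c *\<^sub>R c)"
        using tu(3) insert.hyps by simp
      moreover have "\<forall>c\<in>insert a C. \<bar>(u(a := t)) c\<bar> \<le> b c"
        using tu(1,2) by auto
      ultimately show "z \<in> ?K (insert a C)" by blast
    qed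
    show "?K (insert a C) \<subseteq> ?L"
    proof
      fix z assume "z \<in> ?K (insert a C)"
      then obtain u where u: "\<forall>c\<in>insert a C. \<bar>u c\<bar> \<le> b c" "z = (\<Sum>c\<in>insert a C. u c *\<^sub>R c)"
        by blast
      have "u a *\<^sub>R a \<in> (\<lambda>t. t *\<^sub>R a) ` {- b a..b a}"
        using u(1) by (intro imageI) (auto simp: abs_le_iff)
      moreover have "(\<Sum>c\<in>C. u c *\<^sub>R c) \<in> ?K C" using u(1) by blast
      moreover have "z = u a *\<^sub>R a + (\<Sum>c\<in>C. u c *\<^sub>R c)"
        using u(2) insert.hyps by simp
      ultimately show "z \<in> ?L" by blast
    qed
  qed
  ultimately show ?case by simp
qed

text \<open>A bound on the norm bounds the coefficients in an orthogonal expansion, so the sequence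
  stays in a compact set of bounded combinations.\<close>

lemma bounded_seq_in_span_finite:
  fixes B :: "'a::real_inner set" and X :: "nat \<Rightarrow> 'a"
  assumes "finite B" "\<And>n. X n \<in> span B" "\<And>n. norm (X n) \<le> R"
  shows "\<exists>r. strict_mono r \<and> convergent (X \<circ> r)"
proof -
  obtain C where C: "finite C" "span C = span B" "pairwise orthogonal C"
    using basis_orthogonal[OF assms(1)] by blast
  let ?K = "{\<Sum>c\<in>C. u c *\<^sub>R c | u. \<forall>c\<in>C. \<bar>u c\<bar> \<le> R * norm c / (c \<bullet> c)}"
  have "X n \<in> ?K" for n
  proof -
    have "\<bar>X n \<bullet> c / (c \<bullet> c)\<bar> \<le> R * norm c / (c \<bullet> c)" for c
    proof -
      have "\<bar>X n \<bullet> c\<bar> \<le> R * norm c"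
        using Cauchy_Schwarz_ineq2[of "X n" c] mult_right_mono[OF assms(3)[of n], of "norm c"]
        by simp
      then show ?thesis by (simp add: abs_divide divide_right_mono)
    qed
    moreover have "X n = (\<Sum>c\<in>C. (X n \<bullet> c / (c \<bullet> c)) *\<^sub>R c)"
      using orthogonal_expansion[OF C(1,3)] assms(2) C(2) by blast
    ultimately show ?thesis
      by (intro CollectI exI[of _ "\<lambda>c. X n \<bullet> c / (c \<bullet> c)"] conjI ballI)
  qed
  then have "\<exists>l\<in>?K. \<exists>r. strict_mono r \<and> (X \<circ> r) \<longlonglongrightarrow> l"
    using compact_bounded_combinations[OF C(1), of "\<lambda>c. R * norm c / (c \<bullet> c)"]
    unfolding compact_def by blast
  then show ?thesis
    unfolding convergent_def by blast
qed


section \<open>Adjoints\<close>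

lemma cinner_right_ext:
  fixes y z :: "'a::complex_hilbert_space"
  assumes "\<And>x. cinner x y = cinner x z"
  shows "y = z"
proof -
  have "x \<bullet> y = x \<bullet> z" for x
    using assms by (simp add: inner_eq_Re_cinner)
  then show ?thesis by (metis inner_commute vector_eq_ldot)
qed

lemma cadjoint_eqI:
  assumes "bounded_clinear T" "\<And>x y. cinner (T x) y = cinner x (T' y)"
  shows "cadjoint T = T'"
  using assms by (metis cinner_cadjoint cinner_right_ext ext)

lemma bounded_clinear_compose:
  "bounded_clinear T \<Longrightarrow> bounded_clinear U \<Longrightarrow> bounded_clinear (T \<circ> U)"
  unfolding bounded_clinear_def comp_def by (simp add: bounded_linear_compose)

lemma bounded_clinear_id: "bounded_clinear id"
  unfolding bounded_clinear_def id_def by (simp add: bounded_linear_ident)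

lemma cadjoint_id: "cadjoint id = id"
  by (rule cadjoint_eqI) (simp_all add: bounded_clinear_id)

lemma cadjoint_compose:
  assumes "bounded_clinear T" "bounded_clinear U"
  shows "cadjoint (T \<circ> U) = cadjoint U \<circ> cadjoint T"
  using assms by (intro cadjoint_eqI bounded_clinear_compose) (simp_all add: cinner_cadjoint)

lemma cadjoint_scaleC:
  assumes "bounded_clinear T"
  shows "cadjoint T (c *\<^sub>C x) = c *\<^sub>C cadjoint T x"
  by (rule cinner_right_ext) (simp add: cinner_cadjoint[OF assms, symmetric] cinner_scaleC_right)

lemma cadjoint_add:
  assumes "bounded_clinear T"
  shows "cadjoint T (x + y) = cadjoint T x + cadjoint T y"
  by (rule cinner_right_ext) (simp add: cinner_cadjoint[OF assms, symmetric] cinner_add_right)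

lemma linear_cadjoint:
  assumes "bounded_clinear T"
  shows "linear (cadjoint T)"
  by (rule linearI) (simp_all add: cadjoint_add assms cadjoint_scaleC scaleR_scaleC)

lemma inner_cadjoint:
  assumes "bounded_clinear T"
  shows "T x \<bullet> y = x \<bullet> cadjoint T y"
  by (simp add: inner_eq_Re_cinner cinner_cadjoint[OF assms])


section \<open>Projection valued measures\<close>

lemma pvm_Un:
  assumes "pvm \<Omega> \<A> P" "{} \<in> \<A>" "E \<in> \<A>" "F \<in> \<A>" "E \<inter> F = {}"
  shows "P (E \<union> F) x = P E x + P F x"
proof -
  have "range (binaryset E F) \<subseteq> \<A>"
    using assms by (auto simp: range_binaryset_eq)
  moreover have "disjoint_family (binaryset E F)"
    using assms(5) by (auto simp: disjoint_family_on_def binaryset_def)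
  ultimately have "(\<lambda>n. P (binaryset E F n) x) sums P (\<Union>n. binaryset E F n) x"
    using assms(1) unfolding pvm_def by blast
  moreover have "(\<lambda>n. P (binaryset E F n) x) sums (P E x + P F x)"
    by (rule binaryset_sums) (use assms(1) in \<open>simp add: pvm_def\<close>)
  ultimately show ?thesis
    by (simp add: UN_binaryset_eq sums_iff)
qed

text \<open>As for measures: the differences of successive sets are disjoint, and their projections
  telescope.\<close>

lemma pvm_continuity_from_above:
  assumes P: "pvm \<Omega> \<A> P" and "sigma_algebra \<Omega> \<A>" and E: "range E \<subseteq> \<A>" and dec: "decseq E"
  shows "(\<lambda>n. P (E n) x) \<longlonglongrightarrow> P (\<Inter>n. E n) x"
proof -
  interpret sigma_algebra \<Omega> \<A> by fact
  define F where "F n = E n - E (Suc n)" for n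
  have inter: "(\<Inter>n. E n) \<in> \<A>" using E by (intro countable_INT) auto
  have F: "range F \<subseteq> \<A>" using E by (auto simp: F_def)
  have anti: "E n \<subseteq> E m" if "m \<le> n" for m n
    using dec that by (auto simp: decseq_def)
  have "F m \<inter> F n = {}" if "m < n" for m n
    using anti[of "Suc m" n] that by (auto simp: F_def)
  then have disj: "disjoint_family F"
    unfolding disjoint_family_on_def by (metis inf_commute linorder_neqE_nat)
  have "\<exists>n. z \<in> F n" if "z \<in> E 0" "z \<notin> E m" for z m
    using that(2)
  proof (induction m)
    case 0
    then show ?case using that(1) by simp
  next
    case (Suc m)
    then show ?case by (cases "z \<in> E m") (auto simp: F_def)
  qed
  then have union: "(\<Union>n. F n) = E 0 - (\<Inter>n. E n)"
    using anti[of 0] by (fastforce simp: F_def)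
  have split: "P G x = P H x + P (G - H) x" if "G \<in> \<A>" "H \<in> \<A>" "H \<subseteq> G" for G H
    using pvm_Un[OF P empty_sets, of H "G - H" x] that by (simp add: Diff Un_absorb1)
  have Fn: "P (F n) x = P (E n) x - P (E (Suc n)) x" for n
    using split[of "E n" "E (Suc n)"] anti[of n "Suc n"] E by (auto simp: F_def image_subset_iff)
  have "(\<lambda>n. P (F n) x) sums P (\<Union>n. F n) x"
    using P F disj unfolding pvm_def by blast
  then have "(\<lambda>n. \<Sum>i<n. P (E i) x - P (E (Suc i)) x) \<longlonglongrightarrow> P (E 0 - (\<Inter>n. E n)) x"
    by (simp add: sums_def Fn union)
  moreover have "(\<Sum>i<n. P (E i) x - P (E (Suc i)) x) = P (E 0) x - P (E n) x" for n
    by (rule sum_lessThan_telescope')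
  ultimately have "(\<lambda>n. P (E 0) x - P (E n) x) \<longlonglongrightarrow> P (E 0 - (\<Inter>n. E n)) x"
    by simp
  then have "(\<lambda>n. P (E 0) x - (P (E 0) x - P (E n) x)) \<longlonglongrightarrow>
      P (E 0) x - P (E 0 - (\<Inter>n. E n)) x"
    by (intro tendsto_intros)
  moreover have "P (E 0) x - P (E 0 - (\<Inter>n. E n)) x = P (\<Inter>n. E n) x"
    using split[of "E 0" "\<Inter>n. E n"] inter E by (simp add: image_subset_iff INT_lower)
  ultimately show ?thesis by simp
qed


section \<open>Word operators\<close>

lemma word_op_Nil: "word_op S [] = id"
  by (simp add: word_op_def)

lemma word_op_Cons: "word_op S (i # I) = S i \<circ> word_op S I"
  by (simp add: word_op_def)

lemma word_op_append: "word_op S (I @ J) = word_op S I \<circ> word_op S J"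
  by (induction I) (simp_all add: word_op_Nil word_op_Cons comp_assoc)

lemma bounded_clinear_word_op:
  assumes "cuntz_rep N S" "I \<in> lists {..<N}"
  shows "bounded_clinear (word_op S I)"
  using assms(2)
proof induction
  case Nil
  show ?case unfolding word_op_Nil by (rule bounded_clinear_id)
next
  case (Cons i I)
  with assms(1) show ?case
    unfolding word_op_Cons by (intro bounded_clinear_compose) (auto simp: cuntz_rep_def)
qed

lemma cadjoint_word_op_append:
  assumes "cuntz_rep N S" "I \<in> lists {..<N}" "J \<in> lists {..<N}"
  shows "cadjoint (word_op S (I @ J)) x = cadjoint (word_op S J) (cadjoint (word_op S I) x)"
  using assms by (simp add: word_op_append cadjoint_compose bounded_clinear_word_op)

lemma cadjoint_word_op_word_op:
  assumes S: "cuntz_rep N S" and "I \<in> lists {..<N}" "J \<in> lists {..<N}" "length I = length J"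
  shows "cadjoint (word_op S I) (word_op S J x) = (if I = J then x else 0)"
  using assms(4,2,3)
proof (induction I J rule: list_induct2)
  case Nil
  then show ?case unfolding word_op_Nil cadjoint_id by simp
next
  case (Cons i I j J)
  have bi: "bounded_clinear (S i)" and W: "bounded_clinear (word_op S I)"
    using S Cons.prems bounded_clinear_word_op[OF S] by (auto simp: cuntz_rep_def)
  have "cadjoint (S i) \<circ> S j = (if i = j then id else (\<lambda>_. 0))"
    using S Cons.prems by (simp add: cuntz_rep_def)
  then have ij: "cadjoint (S i) (S j y) = (if i = j then y else 0)" for y
    by (simp add: fun_eq_iff split: if_splits)
  show ?case
    using Cons.IH Cons.prems linear_0[OF linear_cadjoint[OF W]]
    unfolding word_op_Cons cadjoint_compose[OF bi W] by (auto simp: ij)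
qed

lemma norm_word_op:
  assumes "cuntz_rep N S" "I \<in> lists {..<N}"
  shows "norm (word_op S I x) = norm x"
  using assms
  by (simp add: norm_eq_sqrt_inner inner_cadjoint bounded_clinear_word_op cadjoint_word_op_word_op)

lemma cadjoint_word_op_invariant:
  assumes S: "cuntz_rep N S" and M: "\<forall>i<N. \<forall>v\<in>M. cadjoint (S i) v \<in> M"
    and "I \<in> lists {..<N}" "v \<in> M"
  shows "cadjoint (word_op S I) v \<in> M"
  using assms(3,4)
proof (induction arbitrary: v)
  case Nil
  then show ?case unfolding word_op_Nil cadjoint_id by simp
next
  case (Cons i I)
  have "bounded_clinear (S i)" using S Cons.hyps by (simp add: cuntz_rep_def)
  then show ?case
    unfolding word_op_Cons using Cons M by (simp only: cadjoint_compose bounded_clinear_word_op[OF S]) simp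
qed


section \<open>Vectors carried by an infinite word\<close>

definition word_prefix :: "(nat \<Rightarrow> nat) \<Rightarrow> nat \<Rightarrow> nat list" where
  "word_prefix \<omega> n = map \<omega> [0..<n]"

text \<open>The adjoint \<open>S\<^sub>n\<^sup>*\<close> of the operator of the prefix: it strips the first \<open>n\<close> letters of \<open>\<omega>\<close>
  from the front of a vector.\<close>

definition peel ::
    "(nat \<Rightarrow> 'a::complex_hilbert_space \<Rightarrow> 'a) \<Rightarrow> (nat \<Rightarrow> nat) \<Rightarrow> nat \<Rightarrow> 'a \<Rightarrow> 'a" where
  "peel S \<omega> n = cadjoint (word_op S (word_prefix \<omega> n))"

text \<open>The range of the strong limit of the projections \<open>S\<^sub>n S\<^sub>n\<^sup>*\<close>, that is, of \<open>P {\<omega>}\<close>,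
  described by fixed points so that the action of peeling on it becomes a matter of
  splitting prefixes.\<close>

definition carried_by ::
    "(nat \<Rightarrow> 'a::complex_hilbert_space \<Rightarrow> 'a) \<Rightarrow> (nat \<Rightarrow> nat) \<Rightarrow> 'a \<Rightarrow> bool" where
  "carried_by S \<omega> w \<longleftrightarrow> (\<forall>n. word_op S (word_prefix \<omega> n) (peel S \<omega> n w) = w)"

lemma funpow_word_shift: "(word_shift ^^ n) \<omega> k = \<omega> (n + k)"
  by (induction n arbitrary: k) (simp_all add: word_shift_def)

lemma funpow_word_shift_inf_words: "\<omega> \<in> inf_words N \<Longrightarrow> (word_shift ^^ n) \<omega> \<in> inf_words N"
  by (simp add: mem_inf_words funpow_word_shift)

lemma length_word_prefix [simp]: "length (word_prefix \<omega> n) = n"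
  by (simp add: word_prefix_def)

lemma word_prefix_in_lists: "\<omega> \<in> inf_words N \<Longrightarrow> word_prefix \<omega> n \<in> lists {..<N}"
  by (auto simp: word_prefix_def mem_inf_words)

lemma word_prefix_add:
  "word_prefix \<omega> (n + l) = word_prefix \<omega> n @ word_prefix ((word_shift ^^ n) \<omega>) l"
  by (rule nth_equalityI) (auto simp: word_prefix_def nth_append funpow_word_shift)

lemma peel_add:
  assumes "cuntz_rep N S" "\<omega> \<in> inf_words N"
  shows "peel S \<omega> (n + l) x = peel S ((word_shift ^^ n) \<omega>) l (peel S \<omega> n x)"
  using assms
  by (simp add: peel_def word_prefix_add cadjoint_word_op_append word_prefix_in_lists
      funpow_word_shift_inf_words)

lemma linear_peel:
  assumes "cuntz_rep N S" "\<omega> \<in> inf_words N"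
  shows "linear (peel S \<omega> n)"
  unfolding peel_def
  using assms by (intro linear_cadjoint bounded_clinear_word_op word_prefix_in_lists)

lemma carried_by_peel:
  assumes S: "cuntz_rep N S" and \<omega>: "\<omega> \<in> inf_words N" and w: "carried_by S \<omega> w"
  shows "carried_by S ((word_shift ^^ n) \<omega>) (peel S \<omega> n w)"
  unfolding carried_by_def
proof
  fix l
  let ?W = "word_op S (word_prefix ((word_shift ^^ n) \<omega>) l)"
  have "word_op S (word_prefix \<omega> n) (?W (peel S \<omega> (n + l) w)) = w"
    using w[unfolded carried_by_def, rule_format, of "n + l"]
    by (simp add: word_prefix_add word_op_append)
  then have "peel S \<omega> n (word_op S (word_prefix \<omega> n) (?W (peel S \<omega> (n + l) w))) = peel S \<omega> n w"
    by simp
  then show "?W (peel S ((word_shift ^^ n) \<omega>) l (peel S \<omega> n w)) = peel S \<omega> n w"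
    using S \<omega> by (simp add: peel_def[of S \<omega> n] cadjoint_word_op_word_op word_prefix_in_lists peel_add)
qed

lemma norm_peel_carried:
  assumes "cuntz_rep N S" "\<omega> \<in> inf_words N" "carried_by S \<omega> w"
  shows "norm (peel S \<omega> n w) = norm w"
  using assms by (metis carried_by_def norm_word_op word_prefix_in_lists)

lemma carried_by_diff:
  assumes S: "cuntz_rep N S" "\<omega> \<in> inf_words N" and "carried_by S \<omega> w" "carried_by S \<omega> w'"
  shows "carried_by S \<omega> (w - w')"
proof -
  have "linear (word_op S (word_prefix \<omega> n))" for n
    using bounded_clinear_word_op[OF S(1) word_prefix_in_lists[OF S(2)], of n]
    by (simp add: bounded_clinear_def bounded_linear.linear)
  then show ?thesis
    using assms linear_peel[OF S] by (simp add: carried_by_def linear_diff)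
qed

text \<open>Prefixes that reach beyond a position where the words differ are distinct words of equal
  length, whose operators have orthogonal ranges.\<close>

lemma carried_by_orthogonal:
  assumes S: "cuntz_rep N S" and \<omega>: "\<omega> \<in> inf_words N" "\<omega>' \<in> inf_words N" "\<omega> \<noteq> \<omega>'"
    and w: "carried_by S \<omega> w" "carried_by S \<omega>' w'"
  shows "w \<bullet> w' = 0"
proof -
  obtain k where k: "\<omega> k \<noteq> \<omega>' k" using \<omega>(3) by blast
  let ?I = "word_prefix \<omega> (Suc k)" and ?J = "word_prefix \<omega>' (Suc k)"
  have ne: "?I \<noteq> ?J" using k by (simp add: word_prefix_def)
  have L: "?I \<in> lists {..<N}" "?J \<in> lists {..<N}" by (rule word_prefix_in_lists, fact)+
  have "w \<bullet> w' = word_op S ?I (peel S \<omega> (Suc k) w) \<bullet> word_op S ?J (peel S \<omega>' (Suc k) w')"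
    using w by (simp add: carried_by_def)
  also have "\<dots> = peel S \<omega> (Suc k) w \<bullet> cadjoint (word_op S ?I) (word_op S ?J (peel S \<omega>' (Suc k) w'))"
    using S L by (simp add: inner_cadjoint bounded_clinear_word_op)
  also have "\<dots> = 0"
    using ne by (simp add: cadjoint_word_op_word_op[OF S L])
  finally show ?thesis .
qed

lemma dist_peel_nonperiodic:
  assumes S: "cuntz_rep N S" and \<omega>: "\<omega> \<in> inf_words N" and w: "carried_by S \<omega> w"
    and ne: "(word_shift ^^ m) \<omega> \<noteq> (word_shift ^^ n) \<omega>"
  shows "(dist (peel S \<omega> m w) (peel S \<omega> n w))\<^sup>2 = 2 * (norm w)\<^sup>2"
proof -
  have "peel S \<omega> m w \<bullet> peel S \<omega> n w = 0"
    by (rule carried_by_orthogonal[OF S _ _ ne])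
      (auto intro: funpow_word_shift_inf_words carried_by_peel[OF S] \<omega> w)
  moreover have "peel S \<omega> k w \<bullet> peel S \<omega> k w = (norm w)\<^sup>2" for k
    using norm_peel_carried[OF S \<omega> w] by (simp flip: power2_norm_eq_inner)
  ultimately show ?thesis
    by (simp add: dist_norm power2_norm_eq_inner inner_diff_left inner_diff_right inner_commute)
qed

text \<open>If \<open>n\<close> is a period, peeling \<open>n\<close> letters returns to vectors carried by the same word, and
  peeling \<open>m\<close> more letters acts isometrically on all of them. This is what turns a Cauchy
  subsequence of the orbit into recurrence.\<close>

lemma dist_peel_cyclic:
  assumes S: "cuntz_rep N S" and \<omega>: "\<omega> \<in> inf_words N" and w: "carried_by S \<omega> w"
    and fix_n: "(word_shift ^^ n) \<omega> = \<omega>"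
  shows "dist (peel S \<omega> (n + m) w) (peel S \<omega> m w) = dist (peel S \<omega> n w) w"
proof -
  have "carried_by S \<omega> (peel S \<omega> n w)"
    using carried_by_peel[OF S \<omega> w, of n] fix_n by simp
  then have "norm (peel S \<omega> m (peel S \<omega> n w - w)) = norm (peel S \<omega> n w - w)"
    using w by (intro norm_peel_carried[OF S \<omega>] carried_by_diff[OF S \<omega>])
  then show ?thesis
    by (simp add: dist_norm linear_diff[OF linear_peel[OF S \<omega>]] peel_add[OF S \<omega>] fix_n)
qed


section \<open>The spectral projection of a point\<close>

lemma sigma_algebra_word_borel: "sigma_algebra (inf_words N) (word_borel N)"
  unfolding word_borel_def by (rule sigma_algebra_sigma_sets) (auto dest: openin_subset)

lemma cylinder_in_word_borel: "cylinder N I \<in> word_borel N"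
proof -
  have "openin (word_space N) {\<omega> \<in> inf_words N. \<omega> k \<in> {i} \<inter> {..<N}}" for k i
    by (rule openin_continuous_map_preimage[where Y = "discrete_topology {..<N}"])
      (auto simp: word_space_def intro!: continuous_map_product_projection)
  moreover have "{\<omega> \<in> inf_words N. \<omega> k \<in> {i} \<inter> {..<N}} = {\<omega> \<in> inf_words N. \<omega> k = i}" for k i
    by (auto simp: mem_inf_words)
  ultimately have "{\<omega> \<in> inf_words N. \<omega> k = i} \<in> word_borel N" for k i
    unfolding word_borel_def by (simp add: sigma_sets.Basic)
  moreover interpret sigma_algebra "inf_words N" "word_borel N"
    by (rule sigma_algebra_word_borel)
  have "{\<omega> \<in> inf_words N. \<forall>k\<in>{..<length I}. \<omega> k = I ! k} \<in> word_borel N"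
    by (rule sets_Collect_finite_All) (use calculation in auto)
  then show ?thesis by (simp add: cylinder_def Ball_def)
qed

lemma Inter_cylinder_prefix:
  assumes "\<omega> \<in> inf_words N"
  shows "(\<Inter>n. cylinder N (word_prefix \<omega> n)) = {\<omega>}"
proof
  show "(\<Inter>n. cylinder N (word_prefix \<omega> n)) \<subseteq> {\<omega>}"
  proof
    fix \<omega>' assume "\<omega>' \<in> (\<Inter>n. cylinder N (word_prefix \<omega> n))"
    then have "\<forall>k<length (word_prefix \<omega> n). \<omega>' k = word_prefix \<omega> n ! k" for n
      by (simp add: cylinder_def)
    then have "\<omega>' k = \<omega> k" for k
      by (metis length_word_prefix lessI word_prefix_def nth_map_upt add_0 diff_zero)
    then show "\<omega>' \<in> {\<omega>}" by auto
  qed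
qed (use assms in \<open>auto simp: cylinder_def word_prefix_def\<close>)

lemma decseq_cylinder_prefix: "decseq (\<lambda>n. cylinder N (word_prefix \<omega> n))"
  by (auto simp: decseq_def cylinder_def word_prefix_def)

lemma singleton_in_word_borel:
  assumes "\<omega> \<in> inf_words N"
  shows "{\<omega>} \<in> word_borel N"
proof -
  interpret sigma_algebra "inf_words N" "word_borel N"
    by (rule sigma_algebra_word_borel)
  have "(\<Inter>n. cylinder N (word_prefix \<omega> n)) \<in> word_borel N"
    by (intro countable_INT) (auto simp: cylinder_in_word_borel)
  then show ?thesis by (simp add: Inter_cylinder_prefix[OF assms])
qed

lemma pvm_cylinder_prefix:
  assumes "associated_pvm N S P" "\<omega> \<in> inf_words N"
  shows "P (cylinder N (word_prefix \<omega> n)) x = word_op S (word_prefix \<omega> n) (peel S \<omega> n x)"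
  using assms word_prefix_in_lists[OF assms(2), of n] by (simp add: associated_pvm_def peel_def)

lemma word_op_peel_tendsto:
  assumes P: "associated_pvm N S P" and \<omega>: "\<omega> \<in> inf_words N"
  shows "(\<lambda>n. word_op S (word_prefix \<omega> n) (peel S \<omega> n x)) \<longlonglongrightarrow> P {\<omega>} x"
proof -
  have "(\<lambda>n. P (cylinder N (word_prefix \<omega> n)) x) \<longlonglongrightarrow> P (\<Inter>n. cylinder N (word_prefix \<omega> n)) x"
    by (rule pvm_continuity_from_above[OF _ sigma_algebra_word_borel _ decseq_cylinder_prefix])
      (use P in \<open>auto simp: associated_pvm_def cylinder_in_word_borel\<close>)
  then show ?thesis
    by (simp add: pvm_cylinder_prefix[OF P \<omega>] Inter_cylinder_prefix[OF \<omega>])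
qed

lemma carried_by_point_projection:
  assumes P: "associated_pvm N S P" and \<omega>: "\<omega> \<in> inf_words N"
  shows "carried_by S \<omega> (P {\<omega>} x)"
  unfolding carried_by_def
proof
  fix n
  have "cylinder N (word_prefix \<omega> n) \<inter> {\<omega>} = {\<omega>}"
    using Inter_cylinder_prefix[OF \<omega>] by blast
  moreover have "P (cylinder N (word_prefix \<omega> n) \<inter> {\<omega>}) = P (cylinder N (word_prefix \<omega> n)) \<circ> P {\<omega>}"
    using P cylinder_in_word_borel singleton_in_word_borel[OF \<omega>]
    unfolding associated_pvm_def pvm_def by blast
  ultimately show "word_op S (word_prefix \<omega> n) (peel S \<omega> n (P {\<omega>} x)) = P {\<omega>} x"
    by (simp add: fun_eq_iff flip: pvm_cylinder_prefix[OF P \<omega>])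
qed

text \<open>Applying the isometry \<open>S\<^sub>n\<close> to the difference gives \<open>S\<^sub>n S\<^sub>n\<^sup>* x - P {\<omega>} x\<close>, which tends to
  zero.\<close>

lemma peel_diff_tendsto_0:
  assumes S: "cuntz_rep N S" and P: "associated_pvm N S P" and \<omega>: "\<omega> \<in> inf_words N"
  shows "(\<lambda>n. peel S \<omega> n x - peel S \<omega> n (P {\<omega>} x)) \<longlonglongrightarrow> 0"
proof -
  let ?W = "\<lambda>n. word_op S (word_prefix \<omega> n)"
  have W: "linear (?W n)" for n
    using bounded_clinear_word_op[OF S word_prefix_in_lists[OF \<omega>], of n]
    by (simp add: bounded_clinear_def bounded_linear.linear)
  have "(\<lambda>n. ?W n (peel S \<omega> n x) - P {\<omega>} x) \<longlonglongrightarrow> 0"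
    using word_op_peel_tendsto[OF P \<omega>] by (simp add: LIM_zero)
  moreover have "norm (?W n (peel S \<omega> n x) - P {\<omega>} x) = norm (peel S \<omega> n x - peel S \<omega> n (P {\<omega>} x))" for n
  proof -
    have "?W n (peel S \<omega> n (P {\<omega>} x)) = P {\<omega>} x"
      using carried_by_point_projection[OF P \<omega>] by (simp add: carried_by_def)
    then have "?W n (peel S \<omega> n x - peel S \<omega> n (P {\<omega>} x)) = ?W n (peel S \<omega> n x) - P {\<omega>} x"
      by (simp add: linear_diff[OF W])
    then show ?thesis
      by (metis norm_word_op[OF S word_prefix_in_lists[OF \<omega>]])
  qed
  ultimately have "(\<lambda>n. norm (peel S \<omega> n x - peel S \<omega> n (P {\<omega>} x))) \<longlonglongrightarrow> 0"
    by (auto dest: tendsto_norm_zero)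
  then show ?thesis by (rule tendsto_norm_zero_cancel)
qed


section \<open>Vectors eventually peeled into a subspace\<close>

definition eventually_peeled ::
    "(nat \<Rightarrow> 'a::complex_hilbert_space \<Rightarrow> 'a) \<Rightarrow> (nat \<Rightarrow> nat) \<Rightarrow> 'a set \<Rightarrow> 'a set" where
  "eventually_peeled S \<omega> M = {x. \<forall>\<^sub>F n in sequentially. peel S \<omega> n x \<in> M}"

text \<open>The set is a subspace, so by cyclicity it is enough that it contains \<open>S\<^sub>I u\<close> for \<open>u\<close> in \<open>M\<close>.
  Peeling as many letters as \<open>I\<close> has yields \<open>u\<close> or \<open>0\<close>, depending on whether \<open>I\<close> is a prefix of
  \<open>\<omega>\<close>, and \<open>M\<close> is not left afterwards.\<close>

lemma closure_eventually_peeled: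
  assumes S: "cuntz_rep N S" and \<omega>: "\<omega> \<in> inf_words N"
    and M: "complex_vector.subspace M" and inv: "\<forall>i<N. \<forall>v\<in>M. cadjoint (S i) v \<in> M"
    and cyc: "cyclic_for_rep N S M"
  shows "closure (eventually_peeled S \<omega> M) = UNIV"
proof -
  have bc: "bounded_clinear (word_op S (word_prefix \<omega> n))" for n
    using S \<omega> by (intro bounded_clinear_word_op word_prefix_in_lists)
  have sub: "complex_vector.subspace (eventually_peeled S \<omega> M)"
  proof (rule complex_vector.subspaceI)
    show "0 \<in> eventually_peeled S \<omega> M"
      by (simp add: eventually_peeled_def linear_0[OF linear_peel[OF S \<omega>]]
          complex_vector.subspace_0[OF M])
  next
    fix x y assume "x \<in> eventually_peeled S \<omega> M" "y \<in> eventually_peeled S \<omega> M"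
    then have "\<forall>\<^sub>F n in sequentially. peel S \<omega> n x \<in> M \<and> peel S \<omega> n y \<in> M"
      by (simp add: eventually_peeled_def eventually_conj)
    then show "x + y \<in> eventually_peeled S \<omega> M"
      unfolding eventually_peeled_def mem_Collect_eq
      by eventually_elim
        (simp add: linear_add[OF linear_peel[OF S \<omega>]] complex_vector.subspace_add[OF M])
  next
    fix c x assume "x \<in> eventually_peeled S \<omega> M"
    then show "c *\<^sub>C x \<in> eventually_peeled S \<omega> M"
      unfolding eventually_peeled_def mem_Collect_eq
      by eventually_elim
        (simp add: peel_def cadjoint_scaleC[OF bc] complex_vector.subspace_scale[OF M])
  qed
  have gen: "word_op S I (cadjoint (word_op S J) v) \<in> eventually_peeled S \<omega> M"
    if I: "I \<in> lists {..<N}" and J: "J \<in> lists {..<N}" and v: "v \<in> M" for I J v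
  proof -
    define u where "u = cadjoint (word_op S J) v"
    have u: "u \<in> M" unfolding u_def by (rule cadjoint_word_op_invariant[OF S inv J v])
    have "peel S \<omega> (length I + l) (word_op S I u) \<in> M" for l
    proof -
      have "peel S \<omega> (length I) (word_op S I u) \<in> M"
        using u complex_vector.subspace_0[OF M]
        by (simp add: peel_def cadjoint_word_op_word_op[OF S word_prefix_in_lists[OF \<omega>] I])
      then have "peel S ((word_shift ^^ length I) \<omega>) l (peel S \<omega> (length I) (word_op S I u)) \<in> M"
        unfolding peel_def[of S "(word_shift ^^ length I) \<omega>"]
        by (intro cadjoint_word_op_invariant[OF S inv]
            word_prefix_in_lists funpow_word_shift_inf_words \<omega>)
      then show ?thesis by (simp add: peel_add[OF S \<omega>])
    qed
    then have "\<forall>n\<ge>length I. peel S \<omega> n (word_op S I u) \<in> M"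
      by (metis le_add_diff_inverse)
    then show ?thesis
      by (auto simp: eventually_peeled_def eventually_sequentially u_def)
  qed
  have "complex_vector.span {word_op S I (cadjoint (word_op S J) v) | I J v.
          I \<in> lists {..<N} \<and> J \<in> lists {..<N} \<and> v \<in> M} \<subseteq> eventually_peeled S \<omega> M"
    using gen by (intro complex_vector.span_minimal sub) blast
  then show ?thesis
    using cyc closure_mono unfolding cyclic_for_rep_def by blast
qed

text \<open>The density argument common to both kinds of words.\<close>

lemma point_projection_in_closed_set:
  assumes S: "cuntz_rep N S" and P: "associated_pvm N S P" and \<omega>: "\<omega> \<in> inf_words N"
    and M: "complex_vector.subspace M" and inv: "\<forall>i<N. \<forall>v\<in>M. cadjoint (S i) v \<in> M"
    and cyc: "cyclic_for_rep N S M"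
    and "closed A" and A: "\<And>x. x \<in> eventually_peeled S \<omega> M \<Longrightarrow> P {\<omega>} x \<in> A"
  shows "P {\<omega>} x \<in> A"
proof -
  have "bounded_linear (P {\<omega>})"
    using P singleton_in_word_borel[OF \<omega>]
    by (simp add: associated_pvm_def pvm_def orth_projection_def bounded_clinear_def)
  then have "closed (P {\<omega>} -` A)"
    using \<open>closed A\<close> by (intro continuous_closed_vimage) (auto intro: linear_continuous_at)
  moreover have "eventually_peeled S \<omega> M \<subseteq> P {\<omega>} -` A"
    using A by auto
  ultimately have "closure (eventually_peeled S \<omega> M) \<subseteq> P {\<omega>} -` A"
    by (rule closure_minimal[rotated])
  then show ?thesis
    by (auto simp: closure_eventually_peeled[OF S \<omega> M inv cyc])
qed

text \<open>Compactness is available only for the orbit of \<open>x\<close>, which enters the finite-dimensional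
  space; the orbit of the projected vector inherits the limit because the two are asymptotic.
  The parameter \<open>g\<close> allows restriction to multiples of a period.\<close>

lemma convergent_peel_subsequence:
  assumes S: "cuntz_rep N S" and P: "associated_pvm N S P" and \<omega>: "\<omega> \<in> inf_words N"
    and B: "finite B" and x: "x \<in> eventually_peeled S \<omega> (span B)"
    and g: "strict_mono (g :: nat \<Rightarrow> nat)"
  shows "\<exists>r. strict_mono r \<and> convergent (\<lambda>k. peel S \<omega> (g (r k)) (P {\<omega>} x))"
proof -
  obtain m where m: "\<And>n. n \<ge> m \<Longrightarrow> peel S \<omega> n x \<in> span B"
    using x by (auto simp: eventually_peeled_def eventually_sequentially)
  have "Bseq (\<lambda>n. word_op S (word_prefix \<omega> n) (peel S \<omega> n x))"
    using word_op_peel_tendsto[OF P \<omega>] by (intro convergent_imp_Bseq convergentI)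
  then obtain R where R: "\<And>n. norm (peel S \<omega> n x) \<le> R"
    by (auto simp: Bseq_def norm_word_op[OF S word_prefix_in_lists[OF \<omega>]])
  \<comment> \<open>The offset \<open>m\<close> skips the initial part of the orbit, which may lie outside the span.\<close>
  let ?X = "\<lambda>k. peel S \<omega> (g (k + m)) x"
  have "g (k + m) \<ge> m" for k
    using strict_mono_imp_increasing[OF g, of "k + m"] by simp
  then obtain r where r: "strict_mono r" "convergent (?X \<circ> r)"
    using bounded_seq_in_span_finite[OF B, of ?X R] m R by blast
  define r' where "r' k = r k + m" for k
  have r': "strict_mono r'" using r(1) by (auto simp: r'_def strict_mono_def)
  have "(\<lambda>k. peel S \<omega> (g (r' k)) x - peel S \<omega> (g (r' k)) (P {\<omega>} x)) \<longlonglongrightarrow> 0"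
    using LIMSEQ_subseq_LIMSEQ[OF peel_diff_tendsto_0[OF S P \<omega>] strict_mono_o[OF g r']]
    by (simp add: o_def)
  moreover obtain u where "(\<lambda>k. peel S \<omega> (g (r' k)) x) \<longlonglongrightarrow> u"
    using r(2) by (auto simp: o_def r'_def convergent_def)
  ultimately have "(\<lambda>k. peel S \<omega> (g (r' k)) x -
      (peel S \<omega> (g (r' k)) x - peel S \<omega> (g (r' k)) (P {\<omega>} x))) \<longlonglongrightarrow> u - 0"
    by (intro tendsto_diff)
  then have "(\<lambda>k. peel S \<omega> (g (r' k)) (P {\<omega>} x)) \<longlonglongrightarrow> u"
    by simp
  then show ?thesis using r' by (auto simp: convergent_def)
qed

text \<open>Otherwise any two members of the orbit are at distance \<open>sqrt 2\<close> times the norm of the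
  projected vector, so that no subsequence is Cauchy.\<close>

lemma nonperiodic_point_projection_zero:
  assumes S: "cuntz_rep N S" and P: "associated_pvm N S P" and \<omega>: "\<omega> \<in> inf_words N"
    and B: "finite B" and x: "x \<in> eventually_peeled S \<omega> (span B)"
    and np: "\<not> periodic_word \<omega>"
  shows "P {\<omega>} x = 0"
proof (rule ccontr)
  define w where "w = P {\<omega>} x"
  assume "P {\<omega>} x \<noteq> 0"
  then have pos: "norm w > 0" by (simp add: w_def)
  obtain r where r: "strict_mono r" "convergent (\<lambda>k. peel S \<omega> (r k) w)"
    using convergent_peel_subsequence[OF S P \<omega> B x, of "\<lambda>k. k"]
    by (auto simp: w_def strict_mono_def)
  from r(2) have "Cauchy (\<lambda>k. peel S \<omega> (r k) w)" by (rule convergent_Cauchy)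
  from metric_CauchyD[OF this pos] obtain K
    where K: "\<And>a b. a \<ge> K \<Longrightarrow> b \<ge> K \<Longrightarrow> dist (peel S \<omega> (r a) w) (peel S \<omega> (r b) w) < norm w"
    by blast
  have "r K \<noteq> r (Suc K)" using r(1) by (metis lessI less_irrefl strict_monoD)
  then have "(word_shift ^^ r K) \<omega> \<noteq> (word_shift ^^ r (Suc K)) \<omega>"
    using np by (auto simp: periodic_word_def)
  from dist_peel_nonperiodic[OF S \<omega> _ this]
  have "(dist (peel S \<omega> (r K) w) (peel S \<omega> (r (Suc K)) w))\<^sup>2 = 2 * (norm w)\<^sup>2"
    using carried_by_point_projection[OF P \<omega>] by (simp add: w_def)
  moreover have "(dist (peel S \<omega> (r K) w) (peel S \<omega> (r (Suc K)) w))\<^sup>2 < (norm w)\<^sup>2"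
    using K[of K "Suc K"] by (intro power_strict_mono) auto
  ultimately show False by (smt (verit) zero_le_power2)
qed

text \<open>The projected vector is recurrent under peeling by multiples of the period, and its late
  orbit is close to the orbit of \<open>x\<close>, which lies in the span.\<close>

lemma cyclic_point_projection_in_span:
  assumes S: "cuntz_rep N S" and P: "associated_pvm N S P" and \<omega>: "\<omega> \<in> inf_words N"
    and B: "finite B" and x: "x \<in> eventually_peeled S \<omega> (span B)"
    and cyc: "cyclic_word \<omega>"
  shows "P {\<omega>} x \<in> span B"
proof -
  define w where "w = P {\<omega>} x"
  have w: "carried_by S \<omega> w"
    unfolding w_def by (rule carried_by_point_projection[OF P \<omega>])
  obtain p where p: "p > 0" "(word_shift ^^ p) \<omega> = \<omega>"
    using cyc by (auto simp: cyclic_word_def)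
  have fixed: "(word_shift ^^ (k * p)) \<omega> = \<omega>" for k
    by (induction k) (simp_all add: funpow_add p(2))
  obtain m where m: "\<And>n. n \<ge> m \<Longrightarrow> peel S \<omega> n x \<in> span B"
    using x by (auto simp: eventually_peeled_def eventually_sequentially)
  obtain r where r: "strict_mono r" "convergent (\<lambda>k. peel S \<omega> (r k * p) w)"
    using convergent_peel_subsequence[OF S P \<omega> B x, of "\<lambda>k. k * p"] p(1)
    by (auto simp: w_def strict_mono_def)
  have "w \<in> closure (span B)"
    unfolding closure_approachable
  proof (intro allI impI)
    fix e :: real assume "e > 0"
    then have e: "e / 2 > 0" by simp
    obtain n0 where n0: "\<And>n. n \<ge> n0 \<Longrightarrow> norm (peel S \<omega> n x - peel S \<omega> n w) < e / 2"
      using LIMSEQ_D[OF peel_diff_tendsto_0[OF S P \<omega>] e] by (auto simp: w_def)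
    obtain K where K: "\<And>a b. a \<ge> K \<Longrightarrow> b \<ge> K \<Longrightarrow>
        dist (peel S \<omega> (r a * p) w) (peel S \<omega> (r b * p) w) < e / 2"
      using metric_CauchyD[OF convergent_Cauchy[OF r(2)] e] by blast
    \<comment> \<open>Two close members of the subsequence, at indices \<open>K\<close> and \<open>b\<close>, whose positions are so far
      apart that their difference \<open>d\<close> is at least \<open>m\<close> and at least \<open>n0\<close>.\<close>
    define b where "b = r K + m + n0 + K"
    have b: "K \<le> b" "r K + m + n0 \<le> r b"
      using strict_mono_imp_increasing[OF r(1), of b] by (auto simp: b_def)
    define d where "d = (r b - r K) * p"
    have "r b - r K \<le> d" using p(1) by (simp add: d_def)
    then have d: "d \<ge> m" "d \<ge> n0" using b(2) by auto
    have "r b * p = d + r K * p"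
      using b(2) by (simp add: d_def flip: add_mult_distrib)
    then have "dist (peel S \<omega> d w) w < e / 2"
      using K[of b K] b(1) dist_peel_cyclic[OF S \<omega> w, of d "r K * p"] fixed by (simp add: d_def)
    moreover have "dist (peel S \<omega> d x) (peel S \<omega> d w) < e / 2"
      using n0[OF d(2)] by (simp add: dist_norm)
    ultimately have "dist (peel S \<omega> d x) w < e"
      using dist_triangle[of "peel S \<omega> d x" w "peel S \<omega> d w"] by simp
    then show "\<exists>y\<in>span B. dist y w < e" using m[OF d(1)] by blast
  qed
  then show ?thesis by (simp add: closed_span_finite[OF B] w_def)
qed

theorem theorem3p2:
  fixes N :: nat
    and S :: "nat \<Rightarrow> 'a::complex_hilbert_space \<Rightarrow> 'a"
    and P :: "(nat \<Rightarrow> nat) set \<Rightarrow> 'a \<Rightarrow> 'a"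
    and M :: "'a set"
  assumes "N \<ge> 2"
    and "cuntz_rep N S"
    and "associated_pvm N S P"
    and "complex_vector.subspace M"
    and "\<exists>B. finite B \<and> complex_vector.span B = M"
    and "\<forall>i<N. \<forall>v\<in>M. cadjoint (S i) v \<in> M"
    and "cyclic_for_rep N S M"
  shows "(\<forall>\<omega>\<in>inf_words N. \<not> periodic_word \<omega> \<longrightarrow> P {\<omega>} = (\<lambda>_. 0)) \<and>
         (\<forall>\<omega>\<in>inf_words N. cyclic_word \<omega> \<longrightarrow> range (P {\<omega>}) \<subseteq> M)"
proof -
  obtain B where B: "finite B" "M = span B"
    using assms(5) complex_span_eq_real_span by (metis finite_Un finite_imageI)
  note in_closed_set =
    point_projection_in_closed_set[OF assms(2,3) _ assms(4,6,7)]
  have "P {\<omega>} x \<in> {0}" if \<omega>: "\<omega> \<in> inf_words N" "\<not> periodic_word \<omega>" for \<omega> x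
  proof (rule in_closed_set[OF \<omega>(1) closed_singleton])
    fix y assume "y \<in> eventually_peeled S \<omega> M"
    then show "P {\<omega>} y \<in> {0}"
      using nonperiodic_point_projection_zero[OF assms(2,3) \<omega>(1) B(1) _ \<omega>(2)] B(2) by blast
  qed
  moreover have "P {\<omega>} x \<in> M" if \<omega>: "\<omega> \<in> inf_words N" "cyclic_word \<omega>" for \<omega> x
  proof (rule in_closed_set[OF \<omega>(1)])
    show "closed M" unfolding B(2) by (rule closed_span_finite[OF B(1)])
    fix y assume "y \<in> eventually_peeled S \<omega> M"
    then show "P {\<omega>} y \<in> M"
      using cyclic_point_projection_in_span[OF assms(2,3) \<omega>(1) B(1) _ \<omega>(2)] B(2) by blast
  qed
  ultimately show ?thesis by (auto simp: fun_eq_iff)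
qed

end
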